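(* The competitive ratio of First-Fit on the class of 2-count interval graphs is at most $4$.
   Context: A 2-count interval graph is a graph having an interval representation (an assignment of closed real intervals to vertices such that two vertices are adjacent iff their intervals intersect) in which at most two distinct interval lengths occur. First-Fit is the online coloring algorithm that receives the vertices one at a time and assigns each vertex the least positive integer color not used on its previously presented neighbours. For an online algorithm $A$ and graph $G$, $\chi_A(G)$ is the maximum number of colors $A$ uses over all orderings of the vertices of $G$. $A$ is $\rho$-competitive on a class if there is $b\in\mathbb{R}$ with $\chi_A(G)\le\rho\chi(G)+b$ for every $G$ in the class; the competitive ratio of $A$ is the infimum of such $\rho$. *)

theory Defs
  imports
    "Graph_Theory.Pair_Digraph"
    "HOL-Library.Extended_Real"
    "HOL-Combinatorics.Multiset_Permutations"
begin

section \<open>Interval graphs with few interval lengths\<close>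

text \<open>
  Finite simple graphs are the finite symmetric loop-free digraphs of \<^locale>\<open>pair_graph\<close>.
  Vertex \<open>v\<close> is represented by the closed interval \<open>{l v..r v}\<close>, which is required to be
  nonempty; it may be a single point.
\<close>

definition interval_rep ::
  "'a pair_pre_digraph \<Rightarrow> ('a \<Rightarrow> real) \<Rightarrow> ('a \<Rightarrow> real) \<Rightarrow> bool" where
  "interval_rep G l r \<longleftrightarrow>
     (\<forall>v \<in> pverts G. l v \<le> r v) \<and>
     (\<forall>u \<in> pverts G. \<forall>v \<in> pverts G. u \<noteq> v \<longrightarrow>
        ((u, v) \<in> parcs G \<longleftrightarrow> {l u..r u} \<inter> {l v..r v} \<noteq> {}))"

definition count_interval_graph :: "nat \<Rightarrow> 'a pair_pre_digraph \<Rightarrow> bool" where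
  "count_interval_graph k G \<longleftrightarrow> pair_graph G \<and>
     (\<exists>l r. interval_rep G l r \<and> card ((\<lambda>v. r v - l v) ` pverts G) \<le> k)"


section \<open>Chromatic number\<close>

definition proper_coloring :: "'a pair_pre_digraph \<Rightarrow> ('a \<Rightarrow> nat) \<Rightarrow> bool" where
  "proper_coloring G f \<longleftrightarrow> (\<forall>(u, v) \<in> parcs G. f u \<noteq> f v)"

definition chromatic_number :: "'a pair_pre_digraph \<Rightarrow> nat" where
  "chromatic_number G = (LEAST k. \<exists>f. proper_coloring G f \<and> f ` pverts G \<subseteq> {1..k})"


section \<open>Online coloring algorithms\<close>

definition pinduced :: "'a pair_pre_digraph \<Rightarrow> 'a set \<Rightarrow> 'a pair_pre_digraph" where
  "pinduced G S = \<lparr>pverts = pverts G \<inter> S, parcs = parcs G \<inter> S \<times> S\<rparr>"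

text \<open>
  In \<open>A H h v\<close>, \<open>v\<close> is the vertex just presented, \<open>h\<close> lists the previously presented vertices with
  their colors in order of presentation, and \<open>H\<close> is the subgraph induced by all vertices presented
  so far, including \<open>v\<close>.  The result is the color given to \<open>v\<close>.
\<close>

type_synonym 'a online_algorithm =
  "'a pair_pre_digraph \<Rightarrow> ('a \<times> nat) list \<Rightarrow> 'a \<Rightarrow> nat"

primrec run_from ::
  "'a online_algorithm \<Rightarrow> 'a pair_pre_digraph \<Rightarrow> ('a \<times> nat) list \<Rightarrow> 'a list \<Rightarrow> ('a \<times> nat) list" where
  "run_from A G h [] = h"
| "run_from A G h (v # vs) =
     run_from A G (h @ [(v, A (pinduced G (insert v (fst ` set h))) h v)]) vs"

definition colors_used ::
  "'a online_algorithm \<Rightarrow> 'a pair_pre_digraph \<Rightarrow> 'a list \<Rightarrow> nat set" where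
  "colors_used A G vs = snd ` set (run_from A G [] vs)"

definition online_chromatic_number ::
  "'a online_algorithm \<Rightarrow> 'a pair_pre_digraph \<Rightarrow> nat" where
  "online_chromatic_number A G =
     Max ((\<lambda>vs. card (colors_used A G vs)) ` permutations_of_set (pverts G))"

definition first_fit :: "'a online_algorithm" where
  "first_fit H h v = (LEAST c. 1 \<le> c \<and> (\<forall>(u, d) \<in> set h. (u, v) \<in> parcs H \<longrightarrow> d \<noteq> c))"


section \<open>Competitive ratio\<close>

definition competitive ::
  "'a online_algorithm \<Rightarrow> real \<Rightarrow> 'a pair_pre_digraph set \<Rightarrow> bool" where
  "competitive A \<rho> \<C> \<longleftrightarrow>
     (\<exists>b::real. \<forall>G \<in> \<C>. real (online_chromatic_number A G) \<le> \<rho> * real (chromatic_number G) + b)"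

text \<open>
  The infimum is taken in the extended reals: it is \<open>\<infinity>\<close> if no \<open>\<rho>\<close> is admissible, and \<open>- \<infinity>\<close> if the
  admissible \<open>\<rho>\<close> are unbounded below, which happens only for classes on which the algorithm uses a
  bounded number of colors (in particular over a finite type of vertices).
\<close>

definition competitive_ratio ::
  "'a online_algorithm \<Rightarrow> 'a pair_pre_digraph set \<Rightarrow> ereal" where
  "competitive_ratio A \<C> = Inf {ereal \<rho> | \<rho>. competitive A \<rho> \<C>}"

end

theory Submission
  imports Defs
begin

text \<open>
  If a neighbour \<open>u\<close> of \<open>v\<close> is at least as long as \<open>v\<close>, then the interval of \<open>u\<close> contains an
  endpoint of the interval of \<open>v\<close>, and the intervals through one point form a clique, which has at
  most \<open>\<chi>\<close> vertices.  Hence the neighbours of \<open>v\<close> of at least its length, together with \<open>v\<close>, carry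
  at most \<open>2 * \<chi>\<close> colors.  Under First-Fit every color below that of \<open>v\<close> occurs among its
  neighbours, so, by induction on the length, a vertex whose length is the \<open>i\<close>-th smallest gets a
  color of at most \<open>2 * i * \<chi>\<close>.
\<close>

lemma run_from_append:
  "run_from A G h (xs @ ys) = run_from A G (run_from A G h xs) ys"
  by (induction xs arbitrary: h) auto

lemma first_fit_pos: "1 \<le> first_fit H h v"
proof -
  \<comment> \<open>Only finitely many colors occur in \<open>h\<close>; inserting \<open>0\<close>
    makes the fresh color at least 1.\<close>
  obtain c where "c \<notin> insert 0 (snd ` set h)"
    by (metis ex_new_if_finite finite_imageI finite_insert finite_set infinite_UNIV_nat)
  then have "1 \<le> c \<and> (\<forall>(u, d) \<in> set h. (u, v) \<in> parcs H \<longrightarrow> d \<noteq> c)"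
    by force
  then show ?thesis
    unfolding first_fit_def by (rule LeastI2) auto
qed

lemma first_fit_less:
  assumes "1 \<le> c" "c < first_fit H h v"
  shows "\<exists>u. (u, c) \<in> set h \<and> (u, v) \<in> parcs H"
  using not_less_Least[OF assms(2)[unfolded first_fit_def]] assms(1) by auto

text \<open>This replaces a run by a coloring function \<open>col\<close> with the Grundy property:
  each smaller positive color occurs at a neighbour. The bound on the colors is derived from this
  property, without reference to the order of presentation.\<close>

lemma first_fit_run:
  assumes "distinct vs"
  obtains col where
    "set (run_from first_fit G [] vs) = (\<lambda>v. (v, col v)) ` set vs"
    "\<And>v. v \<in> set vs \<Longrightarrow> 1 \<le> col v"
    "\<And>v c. v \<in> set vs \<Longrightarrow> 1 \<le> c \<Longrightarrow> c < col v \<Longrightarrow> \<exists>u \<in> set vs. (u, v) \<in> parcs G \<and> col u = c"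
proof -
  have "\<exists>col. set (run_from first_fit G [] vs) = (\<lambda>v. (v, col v)) ` set vs \<and>
      (\<forall>v \<in> set vs. 1 \<le> col v) \<and>
      (\<forall>v \<in> set vs. \<forall>c. 1 \<le> c \<and> c < col v \<longrightarrow> (\<exists>u \<in> set vs. (u, v) \<in> parcs G \<and> col u = c))"
    using assms
  proof (induction vs rule: rev_induct)
    case Nil
    show ?case by simp
  next
    case (snoc x xs)
    then obtain col where
      run: "set (run_from first_fit G [] xs) = (\<lambda>v. (v, col v)) ` set xs" and
      pos: "\<forall>v \<in> set xs. 1 \<le> col v" and
      below: "\<forall>v \<in> set xs. \<forall>c. 1 \<le> c \<and> c < col v \<longrightarrow>
        (\<exists>u \<in> set xs. (u, v) \<in> parcs G \<and> col u = c)"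
      by auto
    have x: "x \<notin> set xs"
      using snoc.prems by simp
    define h where "h = run_from first_fit G [] xs"
    define cx where "cx = first_fit (pinduced G (insert x (fst ` set h))) h x"
    define col' where "col' = col(x := cx)"
    have col': "col' x = cx" "\<And>v. v \<in> set xs \<Longrightarrow> col' v = col v"
      using x by (auto simp: col'_def)
    \<comment> \<open>Every arc of \<open>pinduced\<close> is an arc of \<open>G\<close>, so the
      vertex blocking \<open>c\<close> is a neighbour in \<open>G\<close> itself.\<close>
    have "\<exists>u \<in> set xs. (u, x) \<in> parcs G \<and> col u = c" if "1 \<le> c" "c < cx" for c
      using first_fit_less[OF that[unfolded cx_def]] run
      by (auto simp: h_def pinduced_def)
    then have "\<exists>u \<in> set xs. (u, v) \<in> parcs G \<and> col' u = c"
      if "v \<in> set (xs @ [x])" "1 \<le> c" "c < col' v" for v c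
      using that below col' by (cases "v = x") auto
    moreover have "1 \<le> col' v" if "v \<in> set (xs @ [x])" for v
      using that pos col' first_fit_pos by (cases "v = x") (auto simp: cx_def)
    moreover have "set (run_from first_fit G [] (xs @ [x])) = (\<lambda>v. (v, col' v)) ` set (xs @ [x])"
      using run col' by (auto simp: run_from_append cx_def h_def)
    ultimately show ?case
      by (intro exI[of _ col']) auto
  qed
  then show thesis
    using that by blast
qed

text \<open>The \<open>LEAST\<close> in the definition is attained because a finite loop-free graph
  is properly colored by any injective numbering of its vertices, shifted by \<open>Suc\<close> to
  avoid 0.\<close>

lemma chromatic_number_coloring:
  assumes "pair_graph G"
  obtains f where "proper_coloring G f" "f ` pverts G \<subseteq> {1..chromatic_number G}"
proof -
  interpret pair_graph G by fact
  obtain g :: "'a \<Rightarrow> nat" where g: "inj_on g (pverts G)"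
    using finite_imp_inj_to_nat_seg[OF pair_finite_verts] by blast
  obtain n where n: "\<And>v. v \<in> pverts G \<Longrightarrow> g v \<le> n"
    using pair_finite_verts finite_nat_set_iff_bounded_le[of "g ` pverts G"] by auto
  have "proper_coloring G (Suc \<circ> g)"
    using inj_onD[OF g] no_loops' in_arcsD1 in_arcsD2
    unfolding proper_coloring_def by fastforce
  moreover have "(Suc \<circ> g) ` pverts G \<subseteq> {1..Suc n}"
    using n by auto
  ultimately have "\<exists>k f. proper_coloring G f \<and> f ` pverts G \<subseteq> {1..k}"
    by blast
  then have "\<exists>f. proper_coloring G f \<and> f ` pverts G \<subseteq> {1..chromatic_number G}"
    unfolding chromatic_number_def by (rule LeastI_ex)
  then show thesis
    using that by blast
qed

text \<open>A proper coloring is injective on a clique.\<close>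

lemma card_intervals_through_point:
  assumes "pair_graph G" "interval_rep G l r"
  shows "card {v \<in> pverts G. x \<in> {l v..r v}} \<le> chromatic_number G"
proof -
  interpret pair_graph G by fact
  obtain f where f: "proper_coloring G f" "f ` pverts G \<subseteq> {1..chromatic_number G}"
    using chromatic_number_coloring[OF assms(1)] by blast
  have "inj_on f {v \<in> pverts G. x \<in> {l v..r v}}"
  proof (rule inj_onI, rule ccontr)
    fix u v
    assume *: "u \<in> {v \<in> pverts G. x \<in> {l v..r v}}" "v \<in> {v \<in> pverts G. x \<in> {l v..r v}}"
      "f u = f v" "u \<noteq> v"
    then have "(u, v) \<in> parcs G"
      using assms(2) unfolding interval_rep_def by blast
    with f(1) *(3) show False
      by (auto simp: proper_coloring_def)
  qed
  moreover have "f ` {v \<in> pverts G. x \<in> {l v..r v}} \<subseteq> {1..chromatic_number G}"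
    using f(2) by blast
  ultimately have "card {v \<in> pverts G. x \<in> {l v..r v}} \<le> card {1..chromatic_number G}"
    by (rule card_inj_on_le) simp
  then show ?thesis
    by simp
qed

text \<open>The cardinality on the right is the rank of the length of \<open>v\<close> among the
  distinct lengths; the induction is on this rank.\<close>

lemma grundy_coloring_le:
  fixes l r :: "'a \<Rightarrow> real"
  assumes G: "pair_graph G" "interval_rep G l r"
    and below: "\<And>v c. v \<in> pverts G \<Longrightarrow> 1 \<le> c \<Longrightarrow> c < col v \<Longrightarrow>
      \<exists>u \<in> pverts G. (u, v) \<in> parcs G \<and> col u = c"
    and v: "v \<in> pverts G"
  defines "len \<equiv> \<lambda>v. r v - l v"
  shows "col v \<le> 2 * chromatic_number G * card {d \<in> len ` pverts G. d \<le> len v}"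
  using v
proof (induction "card {d \<in> len ` pverts G. d \<le> len v}" arbitrary: v rule: less_induct)
  case less
  interpret pair_graph G by fact
  let ?\<chi> = "chromatic_number G" and ?L = "\<lambda>x. {d \<in> len ` pverts G. d \<le> x}"
  have fin: "finite (pverts G)"
    by simp
  \<comment> \<open>\<open>B\<close> is the bound that the induction gives for all vertices strictly
    shorter than \<open>v\<close>.\<close>
  define B where "B = 2 * ?\<chi> * card {d \<in> len ` pverts G. d < len v}"
  define P where "P = (\<lambda>x. {u \<in> pverts G. x \<in> {l u..r u}})"
  have short: "col u \<le> B" if u: "u \<in> pverts G" "len u < len v" for u
  proof -
    have "?L (len u) \<subseteq> {d \<in> len ` pverts G. d < len v}"
      using u by auto
    then have le: "card (?L (len u)) \<le> card {d \<in> len ` pverts G. d < len v}"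
      using fin by (intro card_mono) auto
    \<comment> \<open>The inclusion is strict because \<open>len v\<close> itself belongs only to
      the right-hand set.\<close>
    have "card {d \<in> len ` pverts G. d < len v} < card (?L (len v))"
      using fin less.prems by (intro psubset_card_mono) auto
    with le have "col u \<le> 2 * ?\<chi> * card (?L (len u))"
      using less.hyps u(1) by simp
    also have "\<dots> \<le> B"
      unfolding B_def using le by simp
    finally show ?thesis .
  qed
  \<comment> \<open>The color of \<open>v\<close> is included at no cost, since \<open>v\<close>
    lies in both cliques.\<close>
  have "{B<..col v} \<subseteq> col ` (P (l v) \<union> P (r v))"
  proof
    fix c
    assume c: "c \<in> {B<..col v}"
    show "c \<in> col ` (P (l v) \<union> P (r v))"
    proof (cases "c = col v")
      case True
      then show ?thesis
        using less.prems G(2) by (auto simp: P_def interval_rep_def)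
    next
      case False
      then obtain u where u: "u \<in> pverts G" "(u, v) \<in> parcs G" "col u = c"
        using below[OF less.prems, of c] c by auto
      then have "len v \<le> len u"
        using short[of u] c by fastforce
      moreover have "u \<noteq> v"
        using u(3) False by blast
      then have "{l u..r u} \<inter> {l v..r v} \<noteq> {}"
        using u(1,2) less.prems G(2) unfolding interval_rep_def by blast
      \<comment> \<open>An interval that meets that of \<open>v\<close> but misses both its
        endpoints lies strictly inside it and so is shorter.\<close>
      ultimately have "u \<in> P (l v) \<union> P (r v)"
        using u(1) by (auto simp: P_def len_def)
      with u(3) show ?thesis by blast
    qed
  qed
  then have "card {B<..col v} \<le> card (P (l v) \<union> P (r v))"
    using fin by (intro surj_card_le) (auto simp: P_def)
  also have "\<dots> \<le> card (P (l v)) + card (P (r v))"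
    by (rule card_Un_le)
  also have "\<dots> \<le> 2 * ?\<chi>"
    using card_intervals_through_point[OF G] unfolding P_def mult_2 by (intro add_mono)
  \<comment> \<open>The set \<open>{B<..col v}\<close> has \<open>col v - B\<close> elements; if
    \<open>col v \<le> B\<close>, truncated subtraction gives 0 and the claim still holds.\<close>
  finally have "col v \<le> B + 2 * ?\<chi>"
    by simp
  also have "\<dots> = 2 * ?\<chi> * card (?L (len v))"
  proof -
    have "?L (len v) = insert (len v) {d \<in> len ` pverts G. d < len v}"
      using less.prems by auto
    then have "card (?L (len v)) = Suc (card {d \<in> len ` pverts G. d < len v})"
      using fin by simp
    then show ?thesis
      by (simp add: B_def)
  qed
  finally show ?case .
qed

lemma first_fit_count_interval_graph:
  assumes "count_interval_graph k G"
  shows "online_chromatic_number first_fit G \<le> 2 * k * chromatic_number G"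
proof -
  obtain l r where G: "pair_graph G" "interval_rep G l r"
    and k: "card ((\<lambda>v. r v - l v) ` pverts G) \<le> k"
    using assms unfolding count_interval_graph_def by blast
  interpret pair_graph G by fact
  have "card (colors_used first_fit G vs) \<le> 2 * k * chromatic_number G"
    if vs: "vs \<in> permutations_of_set (pverts G)" for vs
  proof -
    have V: "set vs = pverts G" "distinct vs"
      using vs by (auto simp: permutations_of_set_def)
    obtain col where
      run: "set (run_from first_fit G [] vs) = (\<lambda>v. (v, col v)) ` pverts G" and
      pos: "\<And>v. v \<in> pverts G \<Longrightarrow> 1 \<le> col v" and
      below: "\<And>v c. v \<in> pverts G \<Longrightarrow> 1 \<le> c \<Longrightarrow> c < col v \<Longrightarrow>
        \<exists>u \<in> pverts G. (u, v) \<in> parcs G \<and> col u = c"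
      using first_fit_run[OF V(2), of G] unfolding V(1) by blast
    have "col v \<le> 2 * k * chromatic_number G" if v: "v \<in> pverts G" for v
    proof -
      \<comment> \<open>A rank is at most the number of distinct lengths.\<close>
      have "card {d \<in> (\<lambda>v. r v - l v) ` pverts G. d \<le> r v - l v} \<le> k"
        using k by (intro order.trans[OF card_mono k]) auto
      then have "2 * chromatic_number G * card {d \<in> (\<lambda>v. r v - l v) ` pverts G. d \<le> r v - l v}
          \<le> 2 * chromatic_number G * k"
        by (rule mult_le_mono2)
      from order.trans[OF grundy_coloring_le[OF G below v] this] show ?thesis
        by (simp add: mult_ac)
    qed
    \<comment> \<open>Colors start at 1, so a bound on the largest color also bounds their
      number.\<close>
    then have "colors_used first_fit G vs \<subseteq> {1..2 * k * chromatic_number G}"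
      using pos by (auto simp: colors_used_def run)
    then have "card (colors_used first_fit G vs) \<le> card {1..2 * k * chromatic_number G}"
      by (rule card_mono[OF finite_atLeastAtMost])
    then show ?thesis
      by simp
  qed
  then show ?thesis
    unfolding online_chromatic_number_def by (intro Max.boundedI) auto
qed

theorem theorem15:
  shows "competitive_ratio first_fit {G :: 'a pair_pre_digraph. count_interval_graph 2 G} \<le> 4"
proof -
  \<comment> \<open>The factor is \<open>2 * k\<close> with \<open>k = 2\<close>; the
    \<open>0\<close> is the witness for the additive constant \<open>b\<close>.\<close>
  have "real (online_chromatic_number first_fit G) \<le> 4 * real (chromatic_number G) + 0"
    if "count_interval_graph 2 G" for G :: "'a pair_pre_digraph"
    using first_fit_count_interval_graph[OF that] by simp
  then have "competitive first_fit 4 {G :: 'a pair_pre_digraph. count_interval_graph 2 G}"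
    unfolding competitive_def by blast
  then show ?thesis
    unfolding competitive_ratio_def by (intro Inf_lower) auto
qed

end
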